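(* Let $\psi$ be an entire function and let $\varphi(z)=az+b$, where $a,b\in\mathbb{C}$ and $0<|a|<1$. Suppose that $\psi\left(\frac{b}{1-a}\right)\neq 0$ and that the weighted composition operator $C_{\psi,\varphi}$ is compact on the Fock space $\mathcal{F}^2$. If $a$ is not a positive real number, then the numerical range $W(C_{\psi,\varphi})$ contains $0$ and is closed.
   Context: The Fock space $\mathcal{F}^2$ is the Hilbert space of all entire functions $f:\mathbb{C}\to\mathbb{C}$ that are square integrable with respect to $d\mu(z)=\pi^{-1}e^{-|z|^2}\,dA(z)$, where $dA$ is Lebesgue measure on $\mathbb{C}$, with inner product $\langle f,g\rangle=\int_{\mathbb{C}}f\overline{g}\,d\mu$. For entire functions $\psi,\varphi$, the weighted composition operator is $C_{\psi,\varphi}h=\psi\cdot(h\circ\varphi)$. The numerical range of a bounded operator $T$ on a Hilbert space is $W(T)=\{\langle Tf,f\rangle:\|f\|=1\}$. *)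

theory Defs
  imports "HOL-Complex_Analysis.Complex_Analysis"
begin

definition fock_measure :: "complex measure" where
  "fock_measure = density lborel (\<lambda>z. ennreal (exp (- (cmod z)\<^sup>2) / pi))"

definition fock_space :: "(complex \<Rightarrow> complex) set" where
  "fock_space = {f. f holomorphic_on UNIV \<and> integrable fock_measure (\<lambda>z. (cmod (f z))\<^sup>2)}"

definition fock_inner :: "(complex \<Rightarrow> complex) \<Rightarrow> (complex \<Rightarrow> complex) \<Rightarrow> complex" where
  "fock_inner f g = (\<integral>z. f z * cnj (g z) \<partial>fock_measure)"

definition fock_norm :: "(complex \<Rightarrow> complex) \<Rightarrow> real" where
  "fock_norm f = sqrt (Re (fock_inner f f))"

definition weighted_comp ::
  "(complex \<Rightarrow> complex) \<Rightarrow> (complex \<Rightarrow> complex) \<Rightarrow> (complex \<Rightarrow> complex) \<Rightarrow> complex \<Rightarrow> complex" where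
  "weighted_comp \<psi> \<phi> h = (\<lambda>z. \<psi> z * h (\<phi> z))"

text \<open>
  Operators are functions on all of \<^typ>\<open>complex \<Rightarrow> complex\<close>, of which only the values on
  \<^const>\<open>fock_space\<close> matter; that an operator maps the Fock space into itself is part of the
  definitions below. Boundedness is not listed separately for compact operators, since it
  follows from the sequential condition.
\<close>

definition fock_linear :: "((complex \<Rightarrow> complex) \<Rightarrow> (complex \<Rightarrow> complex)) \<Rightarrow> bool" where
  "fock_linear T \<longleftrightarrow>
     (\<forall>f\<in>fock_space. T f \<in> fock_space) \<and>
     (\<forall>f\<in>fock_space. \<forall>g\<in>fock_space. T (\<lambda>z. f z + g z) = (\<lambda>z. T f z + T g z)) \<and>
     (\<forall>c. \<forall>f\<in>fock_space. T (\<lambda>z. c * f z) = (\<lambda>z. c * T f z))"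

definition fock_compact :: "((complex \<Rightarrow> complex) \<Rightarrow> (complex \<Rightarrow> complex)) \<Rightarrow> bool" where
  "fock_compact T \<longleftrightarrow> fock_linear T \<and>
     (\<forall>F :: nat \<Rightarrow> complex \<Rightarrow> complex.
        (\<forall>n. F n \<in> fock_space) \<and> bounded (range (\<lambda>n. fock_norm (F n))) \<longrightarrow>
        (\<exists>g\<in>fock_space. \<exists>r :: nat \<Rightarrow> nat. strict_mono r \<and>
           (\<lambda>n. fock_norm (\<lambda>z. T (F (r n)) z - g z)) \<longlonglongrightarrow> 0))"

definition numerical_range :: "((complex \<Rightarrow> complex) \<Rightarrow> (complex \<Rightarrow> complex)) \<Rightarrow> complex set" where
  "numerical_range T = {fock_inner (T f) f | f. f \<in> fock_space \<and> fock_norm f = 1}"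

end

theory Submission
  imports Defs "HOL-Probability.Distributions"
begin

text \<open>
  Let \<open>p = b / (1 - a)\<close> be the fixed point of \<open>\<phi>\<close>. The functions \<open>(z - p)\<^sup>n e\<^bsup>\<langle>z, p\<rangle>\<^esup>\<close> form an
  orthogonal basis adapted to the filtration of the Fock space by the order of vanishing at \<open>p\<close>.
  The operator preserves this filtration, so its matrix is triangular with diagonal \<open>\<psi>(p) a\<^sup>n\<close>, and
  these numbers lie in the numerical range. The numerical range is convex (Toeplitz--Hausdorff), and
  the powers of \<open>a\<close> have 0 in their convex hull unless \<open>a > 0\<close>; hence it contains 0. Given 0, it is
  closed: for unit vectors \<open>f\<^sub>n\<close> with \<open>\<langle>T f\<^sub>n, f\<^sub>n\<rangle> \<rightarrow> \<lambda>\<close>, a weak limit \<open>f\<close>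
  of a subsequence satisfies \<open>\<langle>T f, f\<rangle> = \<lambda>\<close> by compactness and \<open>\<parallel>f\<parallel> \<le> 1\<close>, so \<open>\<lambda>\<close> lies on a segment
  joining 0 to a point of the numerical range.
\<close>

subsection \<open>Rotation invariance and radial integrals\<close>

text \<open>The preimage of a box is its image under \<open>inv T\<close>, again an orthogonal map,
  so it keeps the volume of the box. This suffices, since \<open>lborel\<close> is determined by its
  values on boxes.\<close>

lemma distr_lborel_orthogonal_transformation:
  fixes T :: "real^'n::{finite,wellorder} \<Rightarrow> real^'n::_"
  assumes T: "orthogonal_transformation T"
  shows "distr lborel borel T = lborel"
proof (rule lborel_eqI[symmetric])
  have contT: "continuous_on UNIV T"
    by (simp add: T linear_continuous_on orthogonal_transformation_linear linear_linear)
  then have [measurable]: "T \<in> borel_measurable borel"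
    by (rule borel_measurable_continuous_onI)
  fix l u :: "real^'n::{finite,wellorder}" assume le: "\<And>b. b \<in> Basis \<Longrightarrow> l \<bullet> b \<le> u \<bullet> b"
  have bij: "bij T" using T by (rule orthogonal_transformation_bij)
  have pre: "T -` box l u = inv T ` box l u"
    using bij by (simp add: bij_vimage_eq_inv_image)
  have inv: "orthogonal_transformation (inv T)"
    using T by (rule orthogonal_transformation_inv)
  have sets: "T -` box l u \<in> sets borel"
    using measurable_sets_borel[of T borel "box l u"] by simp
  have meas: "T -` box l u \<in> lmeasurable"
    unfolding pre by (rule measurable_orthogonal_image[OF inv]) simp
  have "emeasure (distr lborel borel T) (box l u) = emeasure lborel (T -` box l u)"
    by (simp add: emeasure_distr)
  also have "\<dots> = emeasure lebesgue (T -` box l u)"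
    using sets by (simp add: emeasure_completion)
  also have "\<dots> = ennreal (measure lebesgue (T -` box l u))"
    using meas by (simp add: emeasure_eq_measure2)
  also have "measure lebesgue (T -` box l u) = measure lebesgue (box l u)"
    unfolding pre by (rule measure_orthogonal_image[OF inv]) simp
  also have "\<dots> = (\<Prod>b\<in>Basis. (u - l) \<bullet> b)"
    using le by simp
  finally show "emeasure (distr lborel borel T) (box l u) = (\<Prod>b\<in>Basis. (u - l) \<bullet> b)" .
qed simp

text \<open>Carries facts about \<open>real^2\<close>, where orthogonal maps are available, over to
  the complex plane: boxes correspond to boxes with the same side lengths.\<close>

lemma distr_lborel_Complex:
  "distr lborel borel (\<lambda>v::real^2. Complex (v$1) (v$2)) = lborel"
proof (rule lborel_eqI[symmetric])
  let ?J = "\<lambda>v::real^2. Complex (v$1) (v$2)"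
  have "continuous_on UNIV ?J"
    unfolding complex_eq_iff Complex_eq by (intro continuous_intros)
  then have [measurable]: "?J \<in> borel_measurable borel"
    by (rule borel_measurable_continuous_onI)
  fix l u :: complex assume le: "\<And>b. b \<in> Basis \<Longrightarrow> l \<bullet> b \<le> u \<bullet> b"
  let ?l = "vector [Re l, Im l] :: real^2" and ?u = "vector [Re u, Im u] :: real^2"
  have pre: "?J -` box l u = box ?l ?u"
    by (auto simp: in_box_complex_iff mem_box_cart forall_2)
  have le2: "Re l \<le> Re u" "Im l \<le> Im u"
    using le[of 1] le[of \<i>] by (auto simp: Basis_complex_def)
  have le3: "?l $ i \<le> ?u $ i" for i
    using exhaust_2[of i] le2 by auto
  have *: "emeasure lborel (box ?l ?u) = (\<Prod>b\<in>Basis. (?u - ?l) \<bullet> b)"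
    using le3 by (intro emeasure_lborel_box) (auto simp: Basis_vec_def inner_axis Basis_real_def)
  have "(\<Prod>b\<in>Basis. (?u - ?l) \<bullet> b) = (\<Prod>i\<in>UNIV. (?u - ?l) $ i)"
    unfolding Basis_vec_def Basis_real_def
    by (simp add: UNION_singleton_eq_range prod.reindex inj_on_def axis_eq_axis inner_axis)
  also have "\<dots> = (Re u - Re l) * (Im u - Im l)"
    by (simp add: UNIV_2)
  also have "\<dots> = (\<Prod>b\<in>Basis. (u - l) \<bullet> b)"
    by (simp add: Basis_complex_def)
  finally show "emeasure (distr lborel borel ?J) (box l u) = (\<Prod>b\<in>Basis. (u - l) \<bullet> b)"
    by (simp add: emeasure_distr pre *)
qed simp

lemma distr_lborel_unimodular_mult:
  fixes c :: complex
  assumes "cmod c = 1"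
  shows "distr lborel borel ((*) c) = lborel"
proof -
  let ?J = "\<lambda>v::real^2. Complex (v$1) (v$2)"
  \<comment> \<open>The real matrix of multiplication by \<open>c\<close>; it is orthogonal because
    \<open>c\<close> is unimodular.\<close>
  define T :: "real^2 \<Rightarrow> real^2" where
    "T v = vector [Re c * v$1 - Im c * v$2, Re c * v$2 + Im c * v$1]" for v
  have "continuous_on UNIV ?J"
    unfolding Complex_eq by (intro continuous_intros)
  then have [measurable]: "?J \<in> borel_measurable borel"
    by (rule borel_measurable_continuous_onI)
  have lin: "linear T"
    by (intro linearI) (auto simp: T_def vec_eq_iff forall_2 algebra_simps)
  have c: "(Re c)\<^sup>2 + (Im c)\<^sup>2 = 1"
    using assms cmod_power2[of c] by simp
  have "norm (T v) = norm v" for v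
  proof -
    have "(norm (T v))\<^sup>2 = ((Re c)\<^sup>2 + (Im c)\<^sup>2) * (norm v)\<^sup>2"
      unfolding power2_norm_eq_inner
      by (simp add: inner_vec_def UNIV_2 T_def power2_eq_square algebra_simps)
    then show ?thesis using c by (simp add: power2_eq_iff_nonneg)
  qed
  with lin have T: "orthogonal_transformation T"
    by (simp add: orthogonal_transformation)
  then have [measurable]: "T \<in> borel_measurable borel"
    by (intro borel_measurable_continuous_onI)
      (simp add: linear_continuous_on orthogonal_transformation_linear linear_linear)
  have "distr lborel borel ((*) c) = distr (distr lborel borel ?J) borel ((*) c)"
    by (simp add: distr_lborel_Complex)
  also have "\<dots> = distr lborel borel (((*) c) \<circ> ?J)"
    by (rule distr_distr) auto
  also have "((*) c) \<circ> ?J = ?J \<circ> T"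
    by (auto simp: T_def fun_eq_iff complex_eq_iff)
  also have "distr lborel borel (?J \<circ> T) = distr (distr lborel borel T) borel ?J"
    by (rule distr_distr[symmetric]) auto
  also have "\<dots> = lborel"
    by (simp add: distr_lborel_orthogonal_transformation[OF T] distr_lborel_Complex)
  finally show ?thesis .
qed

section \<open>Circle means and radial integrals of entire functions\<close>

lemma entire_circle_mean:
  assumes "H holomorphic_on UNIV"
  shows "((\<lambda>t. H (exp (2 * of_real pi * \<i> * of_real t) * w)) has_integral H 0) {0..1}"
proof -
  \<comment> \<open>Rescaling the argument reduces every circle around 0 to the unit circle,
    including the degenerate case \<open>w = 0\<close>; Cauchy's formula at the centre then gives
    the mean.\<close>
  have "(\<lambda>u. H (u * w)) holomorphic_on cball 0 1"
    using assms by (intro holomorphic_on_compose_gen[of "\<lambda>u. u * w" _ H UNIV, unfolded o_def])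
      (auto intro!: holomorphic_intros)
  then have "((\<lambda>u. H (u * w) / (u - 0)) has_contour_integral (2 * of_real pi * \<i> * H (0 * w)))
      (circlepath 0 1)"
    by (rule Cauchy_integral_circlepath_simple) simp
  then have "((\<lambda>t. (2 * of_real pi * \<i>) * H (exp (2 * of_real pi * \<i> * of_real t) * w))
      has_integral (2 * of_real pi * \<i>) * H 0) {0..1}"
    unfolding has_contour_integral vector_derivative_circlepath
    by (simp add: circlepath mult_ac)
  from has_integral_mult_right[OF this, of "inverse (2 * of_real pi * \<i>)"] show ?thesis
    by (simp add: field_simps)
qed

lemma integral_unimodular_mult:
  fixes F :: "complex \<Rightarrow> 'a::{banach, second_countable_topology}"
  assumes "cmod c = 1" and [measurable]: "F \<in> borel_measurable borel"
  shows "(\<integral>w. F (c * w) \<partial>lborel) = (\<integral>w. F w \<partial>lborel)"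
    and "integrable lborel (\<lambda>w. F (c * w)) \<longleftrightarrow> integrable lborel F"
proof -
  have "integral\<^sup>L (distr lborel borel ((*) c)) F = (\<integral>w. F (c * w) \<partial>lborel)"
    by (rule integral_distr) auto
  then show "(\<integral>w. F (c * w) \<partial>lborel) = (\<integral>w. F w \<partial>lborel)"
    by (simp add: distr_lborel_unimodular_mult assms)
  have "integrable (distr lborel borel ((*) c)) F \<longleftrightarrow> integrable lborel (\<lambda>w. F (c * w))"
    by (rule integrable_distr_eq) auto
  then show "integrable lborel (\<lambda>w. F (c * w)) \<longleftrightarrow> integrable lborel F"
    by (simp add: distr_lborel_unimodular_mult assms)
qed

lemma entire_borel_measurable:
  "H holomorphic_on UNIV \<Longrightarrow> H \<in> borel_measurable borel"
  by (intro borel_measurable_continuous_onI holomorphic_on_imp_continuous_on)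

text \<open>Rotating the plane by \<open>e t\<close> changes neither the integral nor the radial
  weight. Averaging over \<open>t\<close> and exchanging the integrals replaces \<open>H\<close> by
  its circle means, all equal to \<open>H 0\<close>.\<close>

lemma radial_integral_entire:
  fixes H :: "complex \<Rightarrow> complex" and \<rho> :: "real \<Rightarrow> real"
  assumes H: "H holomorphic_on UNIV" and [measurable]: "\<rho> \<in> borel_measurable borel"
    and int: "integrable lborel (\<lambda>w. \<rho> (cmod w) *\<^sub>R H w)"
  shows "(\<integral>w. \<rho> (cmod w) *\<^sub>R H w \<partial>lborel) = (\<integral>w. \<rho> (cmod w) *\<^sub>R H 0 \<partial>lborel)"
proof -
  have [measurable]: "H \<in> borel_measurable borel"
    using H by (rule entire_borel_measurable)
  define e where "e t = exp (2 * of_real pi * \<i> * of_real t)" for t :: real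
  have e1: "cmod (e t) = 1" for t
    by (simp add: e_def norm_exp_eq_Re)
  have conte: "continuous_on A e" for A
    unfolding e_def by (intro continuous_intros)
  then have [measurable]: "e \<in> borel_measurable borel"
    by (intro borel_measurable_continuous_onI)
  define F where "F w = \<rho> (cmod w) *\<^sub>R H w" for w
  have [measurable]: "F \<in> borel_measurable borel"
    unfolding F_def by measurable
  define I where "I = (indicator {0..1} :: real \<Rightarrow> real)"
  have [measurable]: "I \<in> borel_measurable borel"
    unfolding I_def by measurable
  have intI: "integrable lborel I" "integral\<^sup>L lborel I = 1"
    by (simp_all add: I_def)
  have intF: "integrable lborel (\<lambda>w. F (e t * w))" for t
    using int by (subst integral_unimodular_mult(2)) (simp_all add: e1 F_def[abs_def])
  \<comment> \<open>By rotation invariance the inner integral of the norm is the same for every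
    \<open>t\<close>, so the double integral is finite because \<open>I\<close> is
    integrable.\<close>
  have pairint: "integrable (lborel \<Otimes>\<^sub>M lborel) (\<lambda>(t, w). I t *\<^sub>R F (e t * w))"
  proof (rule lborel_pair.Fubini_integrable)
    have "(\<integral>w. norm (I t *\<^sub>R F (e t * w)) \<partial>lborel) = I t * (\<integral>w. norm (F w) \<partial>lborel)" for t
      using integral_unimodular_mult(1)[of "e t" "\<lambda>w. norm (F w)"] by (simp add: e1 I_def)
    then show "integrable lborel (\<lambda>t. \<integral>w. norm (case (t, w) of (t, w) \<Rightarrow> I t *\<^sub>R F (e t * w)) \<partial>lborel)"
      using intI by simp
  qed (use intF in auto)
  have "(\<integral>w. F w \<partial>lborel) = (\<integral>t. I t *\<^sub>R (\<integral>w. F w \<partial>lborel) \<partial>lborel)"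
    using intI by simp
  also have "\<dots> = (\<integral>t. (\<integral>w. I t *\<^sub>R F (e t * w) \<partial>lborel) \<partial>lborel)"
    by (simp add: integral_unimodular_mult(1) e1)
  also have "\<dots> = (\<integral>w. (\<integral>t. I t *\<^sub>R F (e t * w) \<partial>lborel) \<partial>lborel)"
    using lborel_pair.Fubini_integral[of "\<lambda>t w. I t *\<^sub>R F (e t * w)"] pairint by simp
  also have "(\<lambda>w. \<integral>t. I t *\<^sub>R F (e t * w) \<partial>lborel) = (\<lambda>w. \<rho> (cmod w) *\<^sub>R H 0)"
  proof
    fix w
    have "continuous_on {0..1} (\<lambda>t. H (e t * w))"
      using H by (intro continuous_on_compose2[OF holomorphic_on_imp_continuous_on[OF H]] continuous_intros conte) auto
    then have si: "set_integrable lborel {0..1} (\<lambda>t. H (e t * w))"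
      by (rule borel_integrable_atLeastAtMost')
    have "(\<integral>t. I t *\<^sub>R F (e t * w) \<partial>lborel) = (\<integral>t. \<rho> (cmod w) *\<^sub>R (I t *\<^sub>R H (e t * w)) \<partial>lborel)"
      by (simp add: F_def norm_mult e1 mult_ac)
    also have "\<dots> = \<rho> (cmod w) *\<^sub>R (LINT t:{0..1}|lborel. H (e t * w))"
      unfolding set_lebesgue_integral_def I_def by (rule integral_scaleR_right)
    also have "(LINT t:{0..1}|lborel. H (e t * w)) = H 0"
      using set_borel_integral_eq_integral(2)[OF si] integral_unique[OF entire_circle_mean[OF H, of w]]
      by (simp add: e_def)
    finally show "(\<integral>t. I t *\<^sub>R F (e t * w) \<partial>lborel) = \<rho> (cmod w) *\<^sub>R H 0" .
  qed
  finally show ?thesis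
    by (simp add: F_def)
qed

section \<open>Gaussian moments in the plane\<close>

lemma integrable_gaussian_complex:
  "integrable lborel (\<lambda>z::complex. exp (- (cmod z)\<^sup>2 / 2))"
proof (rule integrableI_nonneg)
  let ?f = "\<lambda>(b::complex) x. ennreal (exp (- x\<^sup>2 / 2))"
  \<comment> \<open>The Gaussian factors over real and imaginary part, so each factor is a multiple
    of the standard normal density.\<close>
  have eq: "ennreal (exp (- (cmod z)\<^sup>2 / 2)) = (\<Prod>b\<in>Basis. ?f b (z \<bullet> b))" for z
    by (simp add: Basis_complex_def ennreal_mult[symmetric] cmod_power2 exp_add[symmetric] field_simps)
  have "integrable lborel (\<lambda>x. sqrt (2 * pi) * std_normal_density x)"
    by (intro integrable_mult_right integrable_normal_density) simp
  then have "integrable lborel (\<lambda>x::real. exp (- x\<^sup>2 / 2))"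
    by (simp add: std_normal_density_def)
  then have fin: "(\<integral>\<^sup>+x. ?f b x \<partial>lborel) < \<infinity>" for b
    by (simp add: integrable_iff_bounded)
  have "(\<integral>\<^sup>+z. ennreal (exp (- (cmod z)\<^sup>2 / 2)) \<partial>lborel) = (\<Prod>b\<in>Basis. \<integral>\<^sup>+x. ?f b x \<partial>lborel)"
    unfolding eq by (rule nn_integral_lborel_prod) auto
  also have "\<dots> < \<infinity>"
    using fin by (simp add: Basis_complex_def ennreal_mult_less_top)
  finally show "(\<integral>\<^sup>+z. ennreal (exp (- (cmod z)\<^sup>2 / 2)) \<partial>(lborel :: complex measure)) < \<infinity>" .
qed auto

lemma power_div_fact_le_exp:
  fixes x :: real
  assumes "0 \<le> x"
  shows "x ^ n / fact n \<le> exp x"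
proof -
  have "(\<Sum>k\<in>{n}. x ^ k /\<^sub>R fact k) \<le> (\<Sum>k. x ^ k /\<^sub>R fact k)"
    using assms by (intro sum_le_suminf summable_exp_generic) auto
  then show ?thesis
    by (simp add: exp_def divide_inverse mult.commute)
qed

text \<open>The bound \<open>x ^ n / fact n \<le> exp x\<close> at
  \<open>x = (cmod z)\<^sup>2 / 2\<close> trades the power of \<open>cmod z\<close> for half of the
  Gaussian decay, with constant \<open>2 ^ n * fact n\<close>; the other half remains
  integrable.\<close>

lemma integrable_gaussian_moment_complex:
  "integrable lborel (\<lambda>z::complex. cmod z ^ (2 * n) * exp (- (cmod z)\<^sup>2))"
proof (rule Bochner_Integration.integrable_bound)
  show "integrable lborel (\<lambda>z::complex. (2 ^ n * fact n) * exp (- (cmod z)\<^sup>2 / 2))"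
    by (intro integrable_mult_right integrable_gaussian_complex)
  have "cmod z ^ (2 * n) * exp (- (cmod z)\<^sup>2) \<le> (2 ^ n * fact n) * exp (- (cmod z)\<^sup>2 / 2)" for z
  proof -
    let ?x = "(cmod z)\<^sup>2 / 2"
    have "?x ^ n / fact n \<le> exp ?x"
      by (rule power_div_fact_le_exp) simp
    then have "cmod z ^ (2 * n) \<le> (2 ^ n * fact n) * exp ?x"
      unfolding power_mult by (simp add: power_divide divide_le_eq mult_ac)
    then have "cmod z ^ (2 * n) * exp (- (cmod z)\<^sup>2) \<le> (2 ^ n * fact n) * exp ?x * exp (- (cmod z)\<^sup>2)"
      by (rule mult_right_mono) simp
    also have "\<dots> = (2 ^ n * fact n) * exp (- (cmod z)\<^sup>2 / 2)"
      by (simp add: mult_exp_exp)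
    finally show ?thesis .
  qed
  then show "AE z in lborel. norm (cmod z ^ (2 * n) * exp (- (cmod z)\<^sup>2)) \<le> norm ((2 ^ n * fact n) * exp (- (cmod z)\<^sup>2 / 2))"
    by (simp add: abs_mult)
qed auto

subsection \<open>The Fock space and its kernels\<close>

lemma sets_fock_measure [measurable_cong, simp]: "sets fock_measure = sets borel"
  by (simp add: fock_measure_def)

lemma space_fock_measure [simp]: "space fock_measure = UNIV"
  by (simp add: fock_measure_def)

lemma
  fixes F :: "complex \<Rightarrow> 'a::{banach, second_countable_topology}"
  assumes [measurable]: "F \<in> borel_measurable borel"
  shows integrable_fock_measure_iff: "integrable fock_measure F \<longleftrightarrow>
          integrable lborel (\<lambda>z. (exp (- (cmod z)\<^sup>2) / pi) *\<^sub>R F z)"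
    and integral_fock_measure: "(\<integral>z. F z \<partial>fock_measure) =
          (\<integral>z. (exp (- (cmod z)\<^sup>2) / pi) *\<^sub>R F z \<partial>lborel)"
  unfolding fock_measure_def
  by (subst integrable_density, simp_all) (subst integral_density, simp_all)

lemma borel_measurable_cnj [measurable (raw)]:
  assumes [measurable]: "f \<in> borel_measurable M"
  shows "(\<lambda>x. cnj (f x)) \<in> borel_measurable M"
  by (rule measurable_compose[OF assms]) (intro borel_measurable_continuous_onI continuous_intros)

lemma fock_spaceD:
  assumes "f \<in> fock_space"
  shows "f holomorphic_on UNIV" "integrable fock_measure (\<lambda>z. (cmod (f z))\<^sup>2)"
    "f \<in> borel_measurable borel"
  using assms entire_borel_measurable by (auto simp: fock_space_def)

lemma integrable_mult_cnj:
  fixes f g :: "'a \<Rightarrow> complex"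
  assumes [measurable]: "f \<in> borel_measurable M" "g \<in> borel_measurable M"
    and "integrable M (\<lambda>x. (cmod (f x))\<^sup>2)" "integrable M (\<lambda>x. (cmod (g x))\<^sup>2)"
  shows "integrable M (\<lambda>x. f x * cnj (g x))"
proof (rule Bochner_Integration.integrable_bound)
  show "integrable M (\<lambda>x. (cmod (f x))\<^sup>2 + (cmod (g x))\<^sup>2)"
    using assms by simp
  have "cmod (f x) * cmod (g x) \<le> (cmod (f x))\<^sup>2 + (cmod (g x))\<^sup>2" for x
    using sum_squares_bound[of "cmod (f x)" "cmod (g x)"]
      mult_nonneg_nonneg[OF norm_ge_zero[of "f x"] norm_ge_zero[of "g x"]] by linarith
  then show "AE x in M. norm (f x * cnj (g x)) \<le> norm ((cmod (f x))\<^sup>2 + (cmod (g x))\<^sup>2)"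
    by (simp add: norm_mult)
qed measurable

text \<open>The inequality for nonnegative extended integrals is applied to the moduli; square
  integrability makes the integrals finite, so the bound can be read back over the reals.\<close>

lemma Cauchy_Schwarz_integral_cnj:
  fixes f g :: "'a \<Rightarrow> complex"
  assumes [measurable]: "f \<in> borel_measurable M" "g \<in> borel_measurable M"
    and f: "integrable M (\<lambda>x. (cmod (f x))\<^sup>2)" and g: "integrable M (\<lambda>x. (cmod (g x))\<^sup>2)"
  shows "cmod (\<integral>x. f x * cnj (g x) \<partial>M) \<le>
    sqrt (\<integral>x. (cmod (f x))\<^sup>2 \<partial>M) * sqrt (\<integral>x. (cmod (g x))\<^sup>2 \<partial>M)"
proof -
  have fg: "integrable M (\<lambda>x. cmod (f x) * cmod (g x))"
    using integrable_norm[OF integrable_mult_cnj[OF assms]] by (simp add: norm_mult)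
  let ?P = "\<integral>x. cmod (f x) * cmod (g x) \<partial>M"
  have "cmod (\<integral>x. f x * cnj (g x) \<partial>M) \<le> ?P"
    using integral_norm_bound[of M "\<lambda>x. f x * cnj (g x)"] by (simp add: norm_mult)
  also have "?P \<le> sqrt ((\<integral>x. (cmod (f x))\<^sup>2 \<partial>M) * (\<integral>x. (cmod (g x))\<^sup>2 \<partial>M))"
  proof (rule real_le_rsqrt)
    have "(\<integral>\<^sup>+x. ennreal (cmod (f x)) * ennreal (cmod (g x)) \<partial>M)\<^sup>2 \<le>
        (\<integral>\<^sup>+x. (ennreal (cmod (f x)))\<^sup>2 \<partial>M) * (\<integral>\<^sup>+x. (ennreal (cmod (g x)))\<^sup>2 \<partial>M)"
      by (rule Cauchy_Schwarz_nn_integral) auto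
    also have "(\<integral>\<^sup>+x. ennreal (cmod (f x)) * ennreal (cmod (g x)) \<partial>M) = ennreal ?P"
      by (simp add: ennreal_mult[symmetric] nn_integral_eq_integral fg)
    also have "(\<integral>\<^sup>+x. (ennreal (cmod (f x)))\<^sup>2 \<partial>M) = ennreal (\<integral>x. (cmod (f x))\<^sup>2 \<partial>M)"
      by (simp add: ennreal_power nn_integral_eq_integral f)
    also have "(\<integral>\<^sup>+x. (ennreal (cmod (g x)))\<^sup>2 \<partial>M) = ennreal (\<integral>x. (cmod (g x))\<^sup>2 \<partial>M)"
      by (simp add: ennreal_power nn_integral_eq_integral g)
    finally have "ennreal (?P\<^sup>2) \<le> ennreal ((\<integral>x. (cmod (f x))\<^sup>2 \<partial>M) * (\<integral>x. (cmod (g x))\<^sup>2 \<partial>M))"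
      by (simp add: ennreal_power[symmetric] ennreal_mult)
    then show "?P\<^sup>2 \<le> (\<integral>x. (cmod (f x))\<^sup>2 \<partial>M) * (\<integral>x. (cmod (g x))\<^sup>2 \<partial>M)"
      by (subst (asm) ennreal_le_iff) (auto intro: mult_nonneg_nonneg)
  qed
  finally show ?thesis by (simp add: real_sqrt_mult)
qed

section \<open>Vector space structure, inner product and norm\<close>

lemma fock_space_add:
  assumes "f \<in> fock_space" "g \<in> fock_space"
  shows "(\<lambda>z. f z + g z) \<in> fock_space"
  unfolding fock_space_def
proof (intro CollectI conjI)
  note [measurable] = fock_spaceD(3)[OF assms(1)] fock_spaceD(3)[OF assms(2)]
  show "(\<lambda>z. f z + g z) holomorphic_on UNIV"
    using assms by (intro holomorphic_intros fock_spaceD)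
  show "integrable fock_measure (\<lambda>z. (cmod (f z + g z))\<^sup>2)"
  proof (rule Bochner_Integration.integrable_bound)
    show "integrable fock_measure (\<lambda>z. 2 * (cmod (f z))\<^sup>2 + 2 * (cmod (g z))\<^sup>2)"
      using assms by (simp add: fock_spaceD)
    have "(cmod (f z + g z))\<^sup>2 \<le> 2 * (cmod (f z))\<^sup>2 + 2 * (cmod (g z))\<^sup>2" for z
    proof -
      have "(cmod (f z + g z))\<^sup>2 \<le> (cmod (f z) + cmod (g z))\<^sup>2"
        by (intro power_mono norm_triangle_ineq) auto
      then show ?thesis
        using sum_squares_bound[of "cmod (f z)" "cmod (g z)"] by (simp add: power2_sum)
    qed
    then show "AE z in fock_measure. norm ((cmod (f z + g z))\<^sup>2) \<le> norm (2 * (cmod (f z))\<^sup>2 + 2 * (cmod (g z))\<^sup>2)"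
      by simp
  qed measurable
qed

lemma fock_space_cmult:
  assumes "f \<in> fock_space"
  shows "(\<lambda>z. c * f z) \<in> fock_space"
  using assms by (auto simp: fock_space_def norm_mult power_mult_distrib intro!: holomorphic_intros)

lemma fock_space_diff:
  assumes "f \<in> fock_space" "g \<in> fock_space"
  shows "(\<lambda>z. f z - g z) \<in> fock_space"
  using fock_space_add[OF assms(1) fock_space_cmult[OF assms(2), of "-1"]] by simp

lemma fock_inner_integrable:
  assumes "f \<in> fock_space" "g \<in> fock_space"
  shows "integrable fock_measure (\<lambda>z. f z * cnj (g z))"
  using fock_spaceD[OF assms(1)] fock_spaceD[OF assms(2)] by (intro integrable_mult_cnj) simp_all

lemma fock_inner_add_left:
  assumes "f \<in> fock_space" "g \<in> fock_space" "h \<in> fock_space"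
  shows "fock_inner (\<lambda>z. f z + g z) h = fock_inner f h + fock_inner g h"
  using assms by (simp add: fock_inner_def algebra_simps fock_inner_integrable)

lemma fock_inner_cmult_left: "fock_inner (\<lambda>z. c * f z) h = c * fock_inner f h"
  by (simp add: fock_inner_def mult.assoc)

lemma fock_inner_commute: "fock_inner f g = cnj (fock_inner g f)"
proof -
  have "cnj (fock_inner g f) = (\<integral>z. cnj (g z * cnj (f z)) \<partial>fock_measure)"
    unfolding fock_inner_def by (rule Bochner_Integration.integral_cnj[symmetric])
  then show ?thesis
    by (simp only: fock_inner_def complex_cnj_mult complex_cnj_cnj mult.commute)
qed

lemma fock_inner_add_right:
  assumes "f \<in> fock_space" "g \<in> fock_space" "h \<in> fock_space"
  shows "fock_inner h (\<lambda>z. f z + g z) = fock_inner h f + fock_inner h g"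
  using assms by (simp add: fock_inner_commute[of h] fock_inner_add_left)

lemma fock_inner_cmult_right: "fock_inner h (\<lambda>z. c * f z) = cnj c * fock_inner h f"
  by (simp add: fock_inner_commute[of h] fock_inner_cmult_left)

lemma fock_inner_diff_left:
  assumes "f \<in> fock_space" "g \<in> fock_space" "h \<in> fock_space"
  shows "fock_inner (\<lambda>z. f z - g z) h = fock_inner f h - fock_inner g h"
  using fock_inner_add_left[OF assms(1) fock_space_cmult[OF assms(2), of "-1"] assms(3)]
    fock_inner_cmult_left[of "-1" g h] by simp

lemma fock_inner_self: "fock_inner f f = complex_of_real (\<integral>z. (cmod (f z))\<^sup>2 \<partial>fock_measure)"
  by (simp add: fock_inner_def complex_norm_square[symmetric] flip: integral_complex_of_real)

lemma fock_norm_eq: "fock_norm f = sqrt (\<integral>z. (cmod (f z))\<^sup>2 \<partial>fock_measure)"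
  by (simp add: fock_norm_def fock_inner_self)

lemma fock_norm_nonneg [simp]: "0 \<le> fock_norm f"
  by (simp add: fock_norm_eq)

lemma fock_norm_square: "complex_of_real ((fock_norm f)\<^sup>2) = fock_inner f f"
  by (simp add: fock_norm_eq fock_inner_self)

lemma fock_norm_cmult: "fock_norm (\<lambda>z. c * f z) = cmod c * fock_norm f"
  by (simp add: fock_norm_eq norm_mult power_mult_distrib real_sqrt_mult)

lemma fock_Cauchy_Schwarz:
  assumes "f \<in> fock_space" "g \<in> fock_space"
  shows "cmod (fock_inner f g) \<le> fock_norm f * fock_norm g"
  unfolding fock_inner_def fock_norm_eq
  using fock_spaceD[OF assms(1)] fock_spaceD[OF assms(2)] by (intro Cauchy_Schwarz_integral_cnj) simp_all

text \<open>The squared norm of the monomial of degree \<open>n\<close>, in fact \<open>n!\<close>.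
  It is kept symbolic; of its value only positivity enters.\<close>

definition fock_moment :: "nat \<Rightarrow> real" where
  "fock_moment n = (\<integral>z. cmod z ^ (2 * n) \<partial>fock_measure)"

lemma integrable_fock_moment: "integrable fock_measure (\<lambda>z. cmod z ^ (2 * n))"
  using integrable_gaussian_moment_complex[of n]
  by (subst integrable_fock_measure_iff) (auto simp: mult.commute)

lemma fock_moment_pos: "0 < fock_moment n"
proof -
  let ?f = "\<lambda>z::complex. (exp (- (cmod z)\<^sup>2) / pi) *\<^sub>R cmod z ^ (2 * n)"
  have int: "integrable lborel ?f"
    using integrable_fock_moment by (subst (asm) integrable_fock_measure_iff) auto
  have eq: "fock_moment n = integral\<^sup>L lborel ?f"
    unfolding fock_moment_def by (rule integral_fock_measure) auto
  have "integral\<^sup>L lborel ?f \<noteq> 0"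
  proof
    assume "integral\<^sup>L lborel ?f = 0"
    then have "AE z in lborel. ?f z = 0"
      using int by (subst (asm) integral_nonneg_eq_0_iff_AE) auto
    \<comment> \<open>The integrand vanishes at most at the origin, which is a null set, so
      otherwise the whole plane would be null.\<close>
    with AE_lborel_singleton[of "0::complex"] have "AE z in (lborel::complex measure). False"
      by eventually_elim auto
    then show False
      by (simp add: AE_iff_null emeasure_lborel_UNIV null_sets_def)
  qed
  moreover have "0 \<le> integral\<^sup>L lborel ?f"
    by (intro Bochner_Integration.integral_nonneg) auto
  ultimately show ?thesis
    unfolding eq by linarith
qed

section \<open>Translations, weighted kernels and point evaluation\<close>

lemma
  fixes F :: "complex \<Rightarrow> 'a::{banach, second_countable_topology}"
  assumes [measurable]: "F \<in> borel_measurable borel"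
  shows integral_lborel_translate: "(\<integral>w. F (p + w) \<partial>lborel) = (\<integral>w. F w \<partial>lborel)"
    and integrable_lborel_translate_iff: "integrable lborel (\<lambda>w. F (p + w)) \<longleftrightarrow> integrable lborel F"
proof -
  have "integral\<^sup>L (distr lborel borel ((+) p)) F = (\<integral>w. F (p + w) \<partial>lborel)"
    by (rule integral_distr) auto
  then show "(\<integral>w. F (p + w) \<partial>lborel) = (\<integral>w. F w \<partial>lborel)"
    by (simp add: lborel_distr_plus)
  have "integrable (distr lborel borel ((+) p)) F \<longleftrightarrow> integrable lborel (\<lambda>w. F (p + w))"
    by (rule integrable_distr_eq) auto
  then show "integrable lborel (\<lambda>w. F (p + w)) \<longleftrightarrow> integrable lborel F"
    by (simp add: lborel_distr_plus)
qed

text \<open>The weighted kernels \<open>(z - p)\<^sup>n e\<^bsup>\<langle>z, p\<rangle>\<^esup>\<close> are, up to scaling, the images of the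
  monomials under the Weyl translation by \<open>p\<close>.\<close>

definition fock_kernel :: "complex \<Rightarrow> nat \<Rightarrow> complex \<Rightarrow> complex" where
  "fock_kernel p n z = (z - p) ^ n * exp (cnj p * z)"

text \<open>In the exponent the terms \<open>(cmod p)\<^sup>2\<close> and \<open>p * cnj w\<close>
  cancel. What is left is a radial factor times an entire one, the form needed for
  \<open>radial_integral_entire\<close>.\<close>

lemma fock_weight_translate:
  "complex_of_real (exp (- (cmod (p + w))\<^sup>2)) * cnj (exp (cnj p * (p + w))) =
   complex_of_real (exp (- (cmod w)\<^sup>2)) * exp (- cnj p * w)"
proof -
  have "complex_of_real (- (cmod (p + w))\<^sup>2) + cnj (cnj p * (p + w)) =
      complex_of_real (- (cmod w)\<^sup>2) - cnj p * w"
    unfolding of_real_minus complex_norm_square by (simp add: algebra_simps)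
  then show ?thesis
    by (simp only: exp_of_real[symmetric] exp_cnj mult_exp_exp) simp
qed

lemma fock_kernel_in_fock_space: "fock_kernel p n \<in> fock_space"
  unfolding fock_space_def
proof (intro CollectI conjI)
  show hol: "fock_kernel p n holomorphic_on UNIV"
    unfolding fock_kernel_def by (intro holomorphic_intros)
  note [measurable] = entire_borel_measurable[OF hol]
  let ?F = "\<lambda>z. (exp (- (cmod z)\<^sup>2) / pi) *\<^sub>R (cmod (fock_kernel p n z))\<^sup>2"
  \<comment> \<open>Centred at \<open>p\<close>, the weighted square of the kernel is a constant
    multiple of a Gaussian moment integrand.\<close>
  have "?F (p + w) = (exp ((cmod p)\<^sup>2) / pi) * (cmod w ^ (2 * n) * exp (- (cmod w)\<^sup>2))" for w
  proof -
    have "- (cmod (p + w))\<^sup>2 + 2 * Re (cnj p * (p + w)) = (cmod p)\<^sup>2 - (cmod w)\<^sup>2"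
      unfolding cmod_power2 by (simp add: power2_eq_square algebra_simps)
    then have "exp (- (cmod (p + w))\<^sup>2) * (cmod (exp (cnj p * (p + w))))\<^sup>2 =
        exp ((cmod p)\<^sup>2) * exp (- (cmod w)\<^sup>2)"
      by (simp only: norm_exp_eq_Re exp_double[symmetric] mult_exp_exp) simp
    then show ?thesis
      by (simp add: fock_kernel_def norm_mult norm_power power_mult_distrib power_mult[symmetric] mult_ac)
  qed
  then have "integrable lborel (\<lambda>w. ?F (p + w))"
    using integrable_gaussian_moment_complex[of n] by simp
  then have "integrable lborel ?F"
    by (subst (asm) integrable_lborel_translate_iff) measurable
  then show "integrable fock_measure (\<lambda>z. (cmod (fock_kernel p n z))\<^sup>2)"
    by (subst integrable_fock_measure_iff) auto
qed

text \<open>With \<open>z = p + w\<close>, the powers \<open>w ^ n\<close> and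
  \<open>cnj w ^ n\<close> combine into a radial factor, and the rest of the integrand is entire in
  \<open>w\<close>; its radial mean is its value at \<open>w = 0\<close>. Thus the kernel reads off
  the leading Taylor coefficient at \<open>p\<close>, and for \<open>n = 0\<close> this is the
  reproducing property up to a constant.\<close>

lemma fock_inner_kernel:
  assumes G: "G holomorphic_on UNIV" and f: "(\<lambda>z. (z - p) ^ n * G z) \<in> fock_space"
  shows "fock_inner (\<lambda>z. (z - p) ^ n * G z) (fock_kernel p n) = complex_of_real (fock_moment n) * G p"
proof -
  note [measurable] = fock_spaceD(3)[OF f] fock_spaceD(3)[OF fock_kernel_in_fock_space[of p n]]
  define h where "h z = (z - p) ^ n * G z * cnj (fock_kernel p n z)" for z
  have [measurable]: "h \<in> borel_measurable borel"
    unfolding h_def by measurable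
  define \<rho> where "\<rho> r = exp (- r\<^sup>2) / pi * r ^ (2 * n)" for r :: real
  have [measurable]: "\<rho> \<in> borel_measurable borel"
    unfolding \<rho>_def by measurable
  define H where "H w = G (p + w) * exp (- cnj p * w)" for w
  have H: "H holomorphic_on UNIV"
    unfolding H_def
    by (intro holomorphic_intros holomorphic_on_compose_gen[of "\<lambda>w. p + w" _ G UNIV, unfolded o_def] G) auto
  let ?F = "\<lambda>z. (exp (- (cmod z)\<^sup>2) / pi) *\<^sub>R h z"
  have F: "?F (p + w) = \<rho> (cmod w) *\<^sub>R H w" for w
  proof -
    have "?F (p + w) = (complex_of_real (exp (- (cmod (p + w))\<^sup>2)) * cnj (exp (cnj p * (p + w)))) *
        ((w * cnj w) ^ n * G (p + w) / of_real pi)"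
      by (simp add: h_def fock_kernel_def scaleR_conv_of_real power_mult_distrib field_simps)
    also have "w * cnj w = of_real ((cmod w)\<^sup>2)"
      by (simp only: complex_norm_square)
    finally show ?thesis
      unfolding fock_weight_translate
      by (simp add: \<rho>_def H_def scaleR_conv_of_real power_mult[symmetric] field_simps)
  qed
  have "integrable fock_measure h"
    unfolding h_def by (rule fock_inner_integrable[OF f fock_kernel_in_fock_space])
  then have "integrable lborel ?F"
    by (subst (asm) integrable_fock_measure_iff) auto
  then have int: "integrable lborel (\<lambda>w. \<rho> (cmod w) *\<^sub>R H w)"
    by (subst (asm) integrable_lborel_translate_iff[where p = p, symmetric]) (auto simp: F)
  have "fock_inner (\<lambda>z. (z - p) ^ n * G z) (fock_kernel p n) = integral\<^sup>L lborel ?F"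
    unfolding fock_inner_def h_def[symmetric] by (rule integral_fock_measure) auto
  also have "\<dots> = (\<integral>w. ?F (p + w) \<partial>lborel)"
    by (rule integral_lborel_translate[symmetric]) auto
  also have "\<dots> = (\<integral>w. \<rho> (cmod w) *\<^sub>R H 0 \<partial>lborel)"
    unfolding F by (rule radial_integral_entire[OF H _ int]) auto
  also have "\<dots> = (\<integral>w. \<rho> (cmod w) \<partial>lborel) *\<^sub>R H 0"
    using integrable_fock_moment[of n]
    by (intro integral_scaleR_left) (subst (asm) integrable_fock_measure_iff, auto simp: \<rho>_def)
  also have "(\<integral>w. \<rho> (cmod w) \<partial>lborel) = fock_moment n"
    unfolding fock_moment_def by (subst integral_fock_measure) (auto simp: \<rho>_def)
  finally show ?thesis
    by (simp add: H_def scaleR_conv_of_real)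
qed

lemma fock_inner_kernel_self:
  "fock_inner (fock_kernel p n) (fock_kernel p n) = complex_of_real (fock_moment n * exp ((cmod p)\<^sup>2))"
proof -
  have "fock_inner (fock_kernel p n) (fock_kernel p n) = complex_of_real (fock_moment n) * exp (cnj p * p)"
    using fock_inner_kernel[of "\<lambda>z. exp (cnj p * z)" p n] fock_kernel_in_fock_space[of p n]
    by (simp add: fock_kernel_def[abs_def] holomorphic_intros)
  also have "cnj p * p = of_real ((cmod p)\<^sup>2)"
    by (simp only: complex_norm_square mult.commute)
  finally show ?thesis
    by (simp only: exp_of_real of_real_mult)
qed

lemma fock_norm_kernel_pos: "0 < fock_norm (fock_kernel p n)"
  by (simp add: fock_norm_def fock_inner_kernel_self fock_moment_pos)

text \<open>Cauchy--Schwarz applied to the reproducing formula with the kernel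
  \<open>fock_kernel z 0\<close>. The bound makes point evaluations continuous, locally uniformly in
  \<open>z\<close>.\<close>

lemma fock_pointwise_bound:
  assumes f: "f \<in> fock_space"
  shows "cmod (f z) \<le> exp ((cmod z)\<^sup>2 / 2) / sqrt (fock_moment 0) * fock_norm f"
proof -
  have "fock_moment 0 * cmod (f z) = cmod (fock_inner f (fock_kernel z 0))"
    using fock_inner_kernel[of f z 0] fock_moment_pos[of 0] fock_spaceD[OF f] f by (simp add: norm_mult)
  also have "\<dots> \<le> fock_norm f * fock_norm (fock_kernel z 0)"
    by (rule fock_Cauchy_Schwarz[OF f fock_kernel_in_fock_space])
  also have "fock_norm (fock_kernel z 0) = sqrt (fock_moment 0) * exp ((cmod z)\<^sup>2 / 2)"
    using exp_double[of "(cmod z)\<^sup>2 / 2"] by (simp add: fock_norm_def fock_inner_kernel_self real_sqrt_mult)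
  finally have le: "fock_moment 0 * cmod (f z) \<le> fock_norm f * (sqrt (fock_moment 0) * exp ((cmod z)\<^sup>2 / 2))" .
  define s where "s = sqrt (fock_moment 0)"
  have s: "0 < s" "fock_moment 0 = s * s"
    using fock_moment_pos[of 0] by (simp_all add: s_def)
  then have "s * (s * cmod (f z)) \<le> s * (exp ((cmod z)\<^sup>2 / 2) * fock_norm f)"
    using le by (simp add: mult_ac)
  then have "s * cmod (f z) \<le> exp ((cmod z)\<^sup>2 / 2) * fock_norm f"
    using s by simp
  then show ?thesis
    using s(1) unfolding s_def[symmetric] by (simp add: field_simps)
qed

lemma fock_norm_eq_0_imp:
  assumes "f \<in> fock_space" "fock_norm f = 0"
  shows "f z = 0"
  using fock_pointwise_bound[OF assms(1), of z] assms(2) by simp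

subsection \<open>Points and convexity of the numerical range\<close>

lemma fock_linearD:
  assumes "fock_linear T"
  shows "f \<in> fock_space \<Longrightarrow> T f \<in> fock_space"
    and "f \<in> fock_space \<Longrightarrow> g \<in> fock_space \<Longrightarrow> T (\<lambda>z. f z + g z) = (\<lambda>z. T f z + T g z)"
    and "f \<in> fock_space \<Longrightarrow> T (\<lambda>z. c * f z) = (\<lambda>z. c * T f z)"
  using assms by (auto simp: fock_linear_def)

lemma numerical_range_memI:
  assumes T: "fock_linear T" and f: "f \<in> fock_space" and "fock_norm f \<noteq> 0"
  shows "fock_inner (T f) f / complex_of_real ((fock_norm f)\<^sup>2) \<in> numerical_range T"
proof -
  let ?c = "complex_of_real (1 / fock_norm f)"
  let ?g = "\<lambda>z. ?c * f z"
  have "fock_inner (T ?g) ?g = ?c * (cnj ?c * fock_inner (T f) f)"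
    by (simp only: fock_linearD(3)[OF T f] fock_inner_cmult_left fock_inner_cmult_right)
  also have "\<dots> = fock_inner (T f) f / complex_of_real ((fock_norm f)\<^sup>2)"
    by (simp add: power2_eq_square)
  finally have "fock_inner (T f) f / complex_of_real ((fock_norm f)\<^sup>2) = fock_inner (T ?g) ?g" ..
  moreover have "fock_norm ?g = 1"
    unfolding fock_norm_cmult using assms(3) by (simp add: norm_divide)
  moreover have "?g \<in> fock_space"
    by (rule fock_space_cmult[OF f])
  ultimately show ?thesis
    unfolding numerical_range_def by blast
qed

lemma fock_inner_combination:
  assumes "f \<in> fock_space" "g \<in> fock_space" "u \<in> fock_space" "v \<in> fock_space"
  shows "fock_inner (\<lambda>z. a * u z + b * v z) (\<lambda>z. c * f z + d * g z) =
    a * cnj c * fock_inner u f + a * cnj d * fock_inner u g +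
    b * cnj c * fock_inner v f + b * cnj d * fock_inner v g"
  by (simp only: fock_inner_add_left fock_inner_add_right fock_space_add fock_space_cmult assms
      fock_inner_cmult_left fock_inner_cmult_right) (simp add: algebra_simps)

text \<open>Toeplitz--Hausdorff. After an affine normalisation sending the two given values to 0 and 1, the phase
  \<open>c\<close> is chosen so that the quadratic form is real on the real span of \<open>f\<close> and \<open>c g\<close>; then the
  intermediate value theorem applies along the segment joining them.\<close>

lemma convex_numerical_range:
  assumes T: "fock_linear T"
  shows "convex (numerical_range T)"
  unfolding convex_alt
proof (intro ballI allI impI)
  fix \<alpha> \<beta> :: complex and t :: real
  assume "\<alpha> \<in> numerical_range T" "\<beta> \<in> numerical_range T" and t: "0 \<le> t \<and> t \<le> 1"
  then obtain f g where f: "f \<in> fock_space" "fock_norm f = 1" and \<alpha>: "\<alpha> = fock_inner (T f) f"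
    and g: "g \<in> fock_space" "fock_norm g = 1" and \<beta>: "\<beta> = fock_inner (T g) g"
    by (auto simp: numerical_range_def)
  show "(1 - t) *\<^sub>R \<alpha> + t *\<^sub>R \<beta> \<in> numerical_range T"
  proof (cases "\<alpha> = \<beta>")
    case True
    then show ?thesis
      using \<open>\<alpha> \<in> numerical_range T\<close> by (simp add: scaleR_left_diff_distrib)
  next
    case False
    define d where "d = \<beta> - \<alpha>"
    have d: "d \<noteq> 0" using False by (simp add: d_def)
    \<comment> \<open>\<open>P\<close> and \<open>Q\<close> are the off-diagonal entries of the
      normalised operator \<open>(T - \<alpha>) / d\<close>, whose values at \<open>f\<close> and
      \<open>g\<close> are 0 and 1.\<close>
    define P where "P = (fock_inner (T g) f - \<alpha> * fock_inner g f) / d"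
    define Q where "Q = (fock_inner (T f) g - \<alpha> * fock_inner f g) / d"
    define D where "D = P - cnj Q"
    \<comment> \<open>Since \<open>cnj c * Q\<close> and \<open>c * cnj Q\<close> are conjugate,
      \<open>c * P + cnj c * Q\<close> has the imaginary part of \<open>c * D\<close>. The phase
      turns \<open>c * D\<close> into \<open>cmod D\<close>; the value 1 keeps \<open>c\<close>
      unimodular when \<open>D = 0\<close>.\<close>
    define c where "c = (if D = 0 then 1 else cnj D / of_real (cmod D))"
    have c: "cmod c = 1"
      by (simp add: c_def norm_divide)
    then have cc: "c * cnj c = 1"
      by (simp add: complex_norm_square[symmetric] del: of_real_power)
    have "c * D = of_real (cmod D)"
      by (simp add: c_def complex_norm_square[symmetric] power2_eq_square mult.commute)
    then have "Im (c * D) = 0"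
      by simp
    then have "Im (c * P + cnj c * Q) = 0"
      by (simp add: D_def algebra_simps)
    then obtain x where x: "c * P + cnj c * Q = complex_of_real x"
      by (metis complex_is_Real_iff Reals_cases)
    define y where "y = 2 * Re (c * fock_inner g f)"
    have y: "c * fock_inner g f + cnj c * fock_inner f g = complex_of_real y"
      unfolding fock_inner_commute[of f g] y_def by (simp add: complex_eq_iff)
    have ff: "fock_inner f f = 1" and gg: "fock_inner g g = 1"
      using fock_norm_square[of f] fock_norm_square[of g] f g by simp_all
    define h where "h s z = complex_of_real (1 - s) * f z + (complex_of_real s * c) * g z" for s z
    \<comment> \<open>\<open>N s\<close> will be the squared norm of \<open>h s\<close>, and
      \<open>M s\<close> the quadratic form of the normalised operator at
      \<open>h s\<close>.\<close>
    define N where "N s = (1 - s)\<^sup>2 + s\<^sup>2 + s * (1 - s) * y" for s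
    define M where "M s = s\<^sup>2 + s * (1 - s) * x" for s
    have h: "h s \<in> fock_space" for s
      unfolding h_def by (intro fock_space_add fock_space_cmult f g)
    have Th: "T (h s) = (\<lambda>z. complex_of_real (1 - s) * T f z + (complex_of_real s * c) * T g z)" for s
      unfolding h_def
      by (simp only: fock_linearD[OF T] f g fock_space_cmult)
    have hh: "fock_inner (h s) (h s) = complex_of_real (N s)" for s
    proof -
      have "fock_inner (h s) (h s) = complex_of_real ((1 - s)\<^sup>2) + complex_of_real (s\<^sup>2) * (c * cnj c) +
          complex_of_real (s * (1 - s)) * (c * fock_inner g f + cnj c * fock_inner f g)"
        unfolding h_def fock_inner_combination[OF f(1) g(1) f(1) g(1)] ff gg
        by (simp add: power2_eq_square algebra_simps)
      then show ?thesis
        by (simp add: cc y N_def)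
    qed
    have Thh: "fock_inner (T (h s)) (h s) = \<alpha> * complex_of_real (N s) + d * complex_of_real (M s)" for s
    proof -
      have 1: "fock_inner (T g) f = d * P + \<alpha> * fock_inner g f"
        "fock_inner (T f) g = d * Q + \<alpha> * fock_inner f g"
        using d by (simp_all add: P_def Q_def)
      have "fock_inner (T (h s)) (h s) = complex_of_real ((1 - s)\<^sup>2) * \<alpha> + complex_of_real (s\<^sup>2) * (c * cnj c) * \<beta> +
          complex_of_real (s * (1 - s)) * (c * fock_inner (T g) f + cnj c * fock_inner (T f) g)"
        unfolding Th unfolding h_def
          fock_inner_combination[OF f(1) g(1) fock_linearD(1)[OF T f(1)] fock_linearD(1)[OF T g(1)]]
          \<alpha>[symmetric] \<beta>[symmetric]
        by (simp add: power2_eq_square algebra_simps)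
      also have "\<dots> = complex_of_real ((1 - s)\<^sup>2) * \<alpha> + complex_of_real (s\<^sup>2) * (\<alpha> + d) +
          complex_of_real (s * (1 - s)) *
            (d * (c * P + cnj c * Q) + \<alpha> * (c * fock_inner g f + cnj c * fock_inner f g))"
        unfolding 1 cc by (simp add: d_def algebra_simps)
      finally show ?thesis
        unfolding x y by (simp add: M_def N_def algebra_simps)
    qed
    have N_norm: "N s = (fock_norm (h s))\<^sup>2" for s
      using fock_norm_square[of "h s"] hh[of s] by (simp only: of_real_eq_iff)
    \<comment> \<open>If \<open>h s\<close> vanished, \<open>f\<close> and \<open>g\<close> would be
      proportional; equal norms force \<open>s = 1 / 2\<close> and a unimodular factor, which leaves
      the quadratic form unchanged and gives \<open>\<alpha> = \<beta>\<close>.\<close>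
    have Npos: "N s \<noteq> 0" if s: "0 \<le> s" "s \<le> 1" for s
    proof
      assume "N s = 0"
      then have "fock_norm (h s) = 0"
        by (simp add: N_norm)
      then have "h s z = 0" for z
        by (rule fock_norm_eq_0_imp[OF h])
      then have eq: "(\<lambda>z. complex_of_real (1 - s) * f z) = (\<lambda>z. (- complex_of_real s * c) * g z)"
        by (simp add: h_def fun_eq_iff eq_neg_iff_add_eq_0)
      from arg_cong[OF eq, of fock_norm] have "1 - s = s"
        unfolding fock_norm_cmult using s f g c by (simp add: norm_mult del: of_real_diff)
      then have s2: "s = 1 / 2" by simp
      have "fock_inner (T (\<lambda>z. b * u z)) (\<lambda>z. b * u z) = b * cnj b * fock_inner (T u) u"
        if "u \<in> fock_space" for b u
        by (simp add: fock_linearD(3)[OF T that] fock_inner_cmult_left fock_inner_cmult_right)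
      from this[OF f(1), of "complex_of_real (1 - s)"] this[OF g(1), of "- complex_of_real s * c"]
      have "complex_of_real (1 - s) * complex_of_real (1 - s) * \<alpha> =
          complex_of_real s * complex_of_real s * (c * cnj c) * \<beta>"
        unfolding eq \<alpha>[symmetric] \<beta>[symmetric] by (simp add: mult_ac)
      then show False
        using False unfolding s2 cc by simp
    qed
    \<comment> \<open>The real quotient runs continuously from 0 at \<open>s = 0\<close> to 1 at
      \<open>s = 1\<close>.\<close>
    have "\<exists>s\<ge>0. s \<le> 1 \<and> M s / N s = t"
    proof (rule IVT')
      show "continuous_on {0..1} (\<lambda>s. M s / N s)"
        using Npos unfolding M_def N_def by (intro continuous_intros) auto
    qed (use t in \<open>auto simp: M_def N_def\<close>)
    then obtain s where s: "0 \<le> s" "s \<le> 1" "M s = t * N s"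
      using Npos by (auto simp: field_simps)
    have "fock_inner (T (h s)) (h s) / complex_of_real ((fock_norm (h s))\<^sup>2) \<in> numerical_range T"
      using Npos[OF s(1,2)] by (intro numerical_range_memI T h) (simp add: N_norm)
    also have "fock_inner (T (h s)) (h s) / complex_of_real ((fock_norm (h s))\<^sup>2) = \<alpha> + d * t"
      unfolding Thh N_norm[symmetric] s(3) using Npos[OF s(1,2)] by (simp add: field_simps)
    also have "\<alpha> + d * t = (1 - t) *\<^sub>R \<alpha> + t *\<^sub>R \<beta>"
      by (simp add: d_def scaleR_conv_of_real algebra_simps)
    finally show ?thesis .
  qed
qed

text \<open>In the orthogonal basis of kernels at the fixed point the operator is lower triangular;
  these are its diagonal entries.\<close>

lemma diagonal_in_numerical_range:
  assumes \<psi>: "\<psi> holomorphic_on UNIV" and lin: "fock_linear (weighted_comp \<psi> (\<lambda>z. a * z + b))"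
    and p: "a * p + b = p"
  shows "\<psi> p * a ^ n \<in> numerical_range (weighted_comp \<psi> (\<lambda>z. a * z + b))"
proof -
  let ?T = "weighted_comp \<psi> (\<lambda>z. a * z + b)"
  let ?k = "fock_kernel p n"
  define G where "G z = \<psi> z * a ^ n * exp (cnj p * (a * z + b))" for z
  have G: "G holomorphic_on UNIV"
    unfolding G_def by (intro holomorphic_intros \<psi>)
  \<comment> \<open>As \<open>p\<close> is fixed, composition only scales \<open>z - p\<close>. The
    image of the kernel keeps its zero of order at least \<open>n\<close> at \<open>p\<close>, and
    pairing with the kernel extracts \<open>G p\<close>.\<close>
  have "a * z + b - p = a * (z - p)" for z
    using p by (simp add: algebra_simps)
  then have T: "?T ?k = (\<lambda>z. (z - p) ^ n * G z)"
    by (simp add: weighted_comp_def fock_kernel_def G_def power_mult_distrib fun_eq_iff)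
  have k: "?k \<in> fock_space"
    by (rule fock_kernel_in_fock_space)
  have "fock_inner (?T ?k) ?k = complex_of_real (fock_moment n) * G p"
    unfolding T by (rule fock_inner_kernel[OF G]) (use fock_linearD(1)[OF lin k] in \<open>simp only: T\<close>)
  also have "G p = \<psi> p * a ^ n * exp (cnj p * p)"
    by (simp add: G_def p)
  also have "cnj p * p = of_real ((cmod p)\<^sup>2)"
    by (simp only: complex_norm_square mult.commute)
  also have "complex_of_real (fock_moment n) * (\<psi> p * a ^ n * exp (of_real ((cmod p)\<^sup>2))) =
      \<psi> p * a ^ n * fock_inner ?k ?k"
    by (simp only: fock_inner_kernel_self exp_of_real of_real_mult mult_ac)
  also have "fock_inner ?k ?k = complex_of_real ((fock_norm ?k)\<^sup>2)"
    by (rule fock_norm_square[symmetric])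
  finally have "fock_inner (?T ?k) ?k / complex_of_real ((fock_norm ?k)\<^sup>2) = \<psi> p * a ^ n"
    using fock_norm_kernel_pos[of p n] by simp
  then show ?thesis
    using numerical_range_memI[OF lin k] fock_norm_kernel_pos[of p n] by simp
qed

text \<open>A half-plane through 0 containing the orbit \<open>v c\<^sup>n\<close> of a rotation would force the nonnegative
  numbers \<open>Re (v c\<^sup>n)\<close> to be summable, since the geometric partial sums are bounded.\<close>

lemma rotation_leaves_half_plane:
  fixes c v :: complex
  assumes c: "cmod c = 1" "Im c \<noteq> 0" and nonneg: "\<And>n. 0 \<le> Re (v * c ^ n)"
  shows "v = 0"
proof -
  have c1: "c \<noteq> 1" using c by auto
  have "summable (\<lambda>n. Re (v * c ^ n))"
  proof (rule summableI_nonneg_bounded)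
    fix n
    have "(\<Sum>i<n. Re (v * c ^ i)) = Re (v * (\<Sum>i<n. c ^ i))"
      by (simp add: sum_distrib_left)
    also have "\<dots> \<le> cmod (v * (\<Sum>i<n. c ^ i))"
      by (rule complex_Re_le_cmod)
    also have "\<dots> = cmod v * (cmod (1 - c ^ n) / cmod (1 - c))"
      using c1 by (simp add: sum_gp_strict norm_mult norm_divide)
    also have "\<dots> \<le> cmod v * (2 / cmod (1 - c))"
      using norm_triangle_ineq4[of 1 "c ^ n"] c
      by (intro mult_left_mono divide_right_mono) (auto simp: norm_power)
    finally show "(\<Sum>i<n. Re (v * c ^ i)) \<le> cmod v * (2 / cmod (1 - c))" .
  qed (rule nonneg)
  then have Re: "(\<lambda>n. Re (v * c ^ n)) \<longlonglongrightarrow> 0"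
    by (rule summable_LIMSEQ_zero)
  \<comment> \<open>The imaginary part is recovered from two consecutive real parts; this is where
    \<open>Im c \<noteq> 0\<close> is used.\<close>
  have "(\<lambda>n. (Re (v * c ^ n) * Re c - Re (v * c ^ Suc n)) / Im c) \<longlonglongrightarrow> (0 * Re c - 0) / Im c"
    by (intro tendsto_intros Re LIMSEQ_Suc[OF Re] c)
  also have "(\<lambda>n. (Re (v * c ^ n) * Re c - Re (v * c ^ Suc n)) / Im c) = (\<lambda>n. Im (v * c ^ n))"
  proof
    fix n
    have "Re (v * c ^ Suc n) = Re ((v * c ^ n) * c)"
      by (simp only: power_Suc mult_ac)
    also have "\<dots> = Re (v * c ^ n) * Re c - Im (v * c ^ n) * Im c"
      by (rule times_complex.sel(1))
    finally show "(Re (v * c ^ n) * Re c - Re (v * c ^ Suc n)) / Im c = Im (v * c ^ n)"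
      using c(2) by (simp only:) simp
  qed
  finally have Im: "(\<lambda>n. Im (v * c ^ n)) \<longlonglongrightarrow> 0" by simp
  have "(\<lambda>n. Complex (Re (v * c ^ n)) (Im (v * c ^ n))) \<longlonglongrightarrow> Complex 0 0"
    by (intro tendsto_Complex Re Im)
  then have "(\<lambda>n. cmod (v * c ^ n)) \<longlonglongrightarrow> 0"
    by (simp only: complex.collapse Complex_eq_0 tendsto_norm_zero_iff zero_complex.code[symmetric])
  \<comment> \<open>The modulus of \<open>v * c ^ n\<close> is constantly \<open>cmod v\<close>, so
    its limit 0 forces \<open>v = 0\<close>.\<close>
  then show ?thesis
    using c by (simp add: norm_mult norm_power LIMSEQ_const_iff)
qed

text \<open>For negative \<open>a\<close>, 0 lies on the segment from \<open>k\<close> to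
  \<open>k * a\<close>. For nonreal \<open>a\<close>, a hyperplane separating 0 from
  \<open>V\<close> would confine the whole orbit to a closed half-plane, which its rotation
  forbids.\<close>

lemma zero_in_convex_geometric:
  fixes V :: "complex set"
  assumes V: "convex V" "\<And>n. k * a ^ n \<in> V"
    and a: "a \<noteq> 0" "\<not> (\<exists>r::real. r > 0 \<and> a = complex_of_real r)"
  shows "0 \<in> V"
proof (cases "k = 0")
  case True
  then show ?thesis using V(2)[of 0] by simp
next
  case k: False
  show ?thesis
  proof (cases "Im a = 0")
    case True
    then have ar: "a = of_real (Re a)"
      by (simp add: complex_eq_iff)
    have neg: "Re a < 0"
      using a ar by (metis linorder_neqE_linordered_idom of_real_0)
    \<comment> \<open>The weights are the solution of \<open>x + y = 1\<close> and
      \<open>x + y * a = 0\<close>.\<close>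
    have "(- Re a / (1 - Re a)) *\<^sub>R (k * a ^ 0) + (1 / (1 - Re a)) *\<^sub>R (k * a ^ 1) \<in> V"
      using neg by (intro convexD[OF V(1)] V(2)) (auto simp: field_simps)
    also have "(- Re a / (1 - Re a)) *\<^sub>R (k * a ^ 0) + (1 / (1 - Re a)) *\<^sub>R (k * a ^ 1) = 0"
      using ar by (simp add: scaleR_conv_of_real)
    finally show ?thesis .
  next
    case False
    show ?thesis
    proof (rule ccontr)
      assume "0 \<notin> V"
      then obtain u where u: "u \<noteq> 0" "\<And>x. x \<in> V \<Longrightarrow> 0 \<le> inner u x"
        using separating_hyperplane_set_0[OF V(1)] by blast
      \<comment> \<open>Dividing by the positive number \<open>cmod a ^ n\<close> does not affect
        the half-plane condition, so only the rotation part of \<open>a\<close> matters.\<close>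
      define c where "c = a / of_real (cmod a)"
      have "cnj u * k = 0"
      proof (rule rotation_leaves_half_plane)
        show "cmod c = 1" "Im c \<noteq> 0"
          using a False by (simp_all add: c_def norm_divide)
        fix n
        have "0 \<le> inner u (k * a ^ n)"
          by (intro u V)
        also have "inner u (k * a ^ n) = Re (cnj u * k * a ^ n)"
          by (simp add: inner_complex_def algebra_simps)
        also have "a ^ n = of_real (cmod a ^ n) * c ^ n"
          using a by (simp add: c_def power_divide)
        also have "Re (cnj u * k * (of_real (cmod a ^ n) * c ^ n)) = cmod a ^ n * Re (cnj u * k * c ^ n)"
          by (simp only: mult_scaleR_right scaleR_complex.sel flip: scaleR_conv_of_real)
        finally have "0 \<le> cmod a ^ n * Re (cnj u * k * c ^ n)" .
        moreover have "0 < cmod a ^ n"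
          using a(1) by simp
        ultimately show "0 \<le> Re (cnj u * k * c ^ n)"
          by (meson zero_le_mult_iff not_less)
      qed
      with u k show False by simp
    qed
  qed
qed

subsection \<open>Weak limits and closedness\<close>

text \<open>Fatou's lemma for the squared moduli: the norm is lower semicontinuous under pointwise
  convergence.\<close>

lemma fock_pointwise_limit_in_fock_space:
  assumes F: "\<And>n. F n \<in> fock_space" "\<And>n. fock_norm (F n) \<le> B"
    and f: "f holomorphic_on UNIV" and lim: "\<And>z. (\<lambda>n. F n z) \<longlonglongrightarrow> f z"
  shows "f \<in> fock_space" and "fock_norm f \<le> B"
proof -
  note [measurable] = fock_spaceD(3)[OF F(1)] entire_borel_measurable[OF f]
  have B: "0 \<le> B"
    using F(2)[of 0] fock_norm_nonneg[of "F 0"] by linarith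
  have "(\<integral>\<^sup>+z. ennreal ((cmod (f z))\<^sup>2) \<partial>fock_measure) =
      (\<integral>\<^sup>+z. liminf (\<lambda>n. ennreal ((cmod (F n z))\<^sup>2)) \<partial>fock_measure)"
  proof (intro nn_integral_cong)
    fix z
    have lim2: "(\<lambda>n. ennreal ((cmod (F n z))\<^sup>2)) \<longlonglongrightarrow> ennreal ((cmod (f z))\<^sup>2)"
      by (intro tendsto_ennrealI tendsto_intros lim)
    show "ennreal ((cmod (f z))\<^sup>2) = liminf (\<lambda>n. ennreal ((cmod (F n z))\<^sup>2))"
      by (rule lim_imp_Liminf[OF sequentially_bot lim2, symmetric])
  qed
  also have "\<dots> \<le> liminf (\<lambda>n. \<integral>\<^sup>+z. ennreal ((cmod (F n z))\<^sup>2) \<partial>fock_measure)"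
    by (rule nn_integral_liminf) measurable
  also have "\<dots> \<le> liminf (\<lambda>n::nat. ennreal (B\<^sup>2))"
  proof (intro Liminf_mono always_eventually allI)
    fix n
    have "(\<integral>z. (cmod (F n z))\<^sup>2 \<partial>fock_measure) = (fock_norm (F n))\<^sup>2"
      by (simp add: fock_norm_eq)
    also have "\<dots> \<le> B\<^sup>2"
      using F(2) by (intro power_mono) auto
    finally show "(\<integral>\<^sup>+z. ennreal ((cmod (F n z))\<^sup>2) \<partial>fock_measure) \<le> ennreal (B\<^sup>2)"
      using fock_spaceD(2)[OF F(1)] by (simp add: nn_integral_eq_integral ennreal_leI)
  qed
  finally have le: "(\<integral>\<^sup>+z. ennreal ((cmod (f z))\<^sup>2) \<partial>fock_measure) \<le> ennreal (B\<^sup>2)"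
    by (simp add: Liminf_const)
  then have int: "integrable fock_measure (\<lambda>z. (cmod (f z))\<^sup>2)"
    by (intro integrableI_nonneg) (auto intro: le_less_trans)
  then show "f \<in> fock_space"
    using f by (simp add: fock_space_def)
  have "(\<integral>z. (cmod (f z))\<^sup>2 \<partial>fock_measure) \<le> B\<^sup>2"
    using le int by (simp add: nn_integral_eq_integral)
  then show "fock_norm f \<le> B"
    unfolding fock_norm_eq using B by (intro real_le_lsqrt) auto
qed

text \<open>Norm bounds give uniform bounds on compact sets, so Montel's theorem yields a convergent
  subsequence with entire limit. This replaces weak compactness of the ball.\<close>

lemma fock_bounded_imp_pointwise_subseq:
  assumes F: "\<And>n. F n \<in> fock_space" "\<And>n. fock_norm (F n) \<le> B"
  obtains f r where "f \<in> fock_space" "fock_norm f \<le> B" "strict_mono (r :: nat \<Rightarrow> nat)"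
    "\<And>z. (\<lambda>n. F (r n) z) \<longlonglongrightarrow> f z"
proof -
  have B: "0 \<le> B"
    using F(2)[of 0] fock_norm_nonneg[of "F 0"] by linarith
  obtain f r where f: "f holomorphic_on UNIV" "strict_mono (r :: nat \<Rightarrow> nat)"
    "\<And>z. z \<in> UNIV \<Longrightarrow> (\<lambda>n. F (r n) z) \<longlonglongrightarrow> f z"
  proof (rule Montel[of UNIV "range F" F])
    fix K :: "complex set"
    assume "compact K"
    then obtain R where R: "\<And>z. z \<in> K \<Longrightarrow> cmod z \<le> R"
      using compact_imp_bounded bounded_iff by metis
    show "\<exists>C. \<forall>h\<in>range F. \<forall>z\<in>K. cmod (h z) \<le> C"
    proof (intro exI ballI)
      fix h z assume "h \<in> range F" and z: "z \<in> K"
      then obtain n where h: "h = F n" by blast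
      have "cmod (h z) \<le> exp ((cmod z)\<^sup>2 / 2) / sqrt (fock_moment 0) * fock_norm h"
        unfolding h by (rule fock_pointwise_bound[OF F(1)])
      also have "\<dots> \<le> exp (R\<^sup>2 / 2) / sqrt (fock_moment 0) * B"
        using power_mono[OF R[OF z] norm_ge_zero, of 2] F(2)[of n] fock_moment_pos[of 0] B
        unfolding h by (intro mult_mono divide_right_mono) auto
      finally show "cmod (h z) \<le> exp (R\<^sup>2 / 2) / sqrt (fock_moment 0) * B" .
    qed
  qed (use fock_spaceD(1)[OF F(1)] in auto)
  show ?thesis
  proof (rule that)
    show "f \<in> fock_space" "fock_norm f \<le> B"
      using fock_pointwise_limit_in_fock_space[of "\<lambda>n. F (r n)" B f] F f by auto
  qed (use f in auto)
qed

lemma fock_norm_limit_imp_pointwise: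
  assumes "\<And>n. F n \<in> fock_space" "f \<in> fock_space" "(\<lambda>n. fock_norm (\<lambda>z. F n z - f z)) \<longlonglongrightarrow> 0"
  shows "(\<lambda>n. F n z) \<longlonglongrightarrow> f z"
proof (rule Lim_transform_bound[where g = "\<lambda>n. exp ((cmod z)\<^sup>2 / 2) / sqrt (fock_moment 0) * fock_norm (\<lambda>z. F n z - f z)",
      THEN LIM_zero_cancel])
  show "\<forall>\<^sub>F n in sequentially. norm (F n z - f z) \<le>
      norm (exp ((cmod z)\<^sup>2 / 2) / sqrt (fock_moment 0) * fock_norm (\<lambda>z. F n z - f z))"
  proof (intro always_eventually allI)
    fix n
    have "cmod (F n z - f z) \<le> exp ((cmod z)\<^sup>2 / 2) / sqrt (fock_moment 0) * fock_norm (\<lambda>z. F n z - f z)"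
      using fock_pointwise_bound[OF fock_space_diff[OF assms(1,2)]] .
    then show "norm (F n z - f z) \<le>
        norm (exp ((cmod z)\<^sup>2 / 2) / sqrt (fock_moment 0) * fock_norm (\<lambda>z. F n z - f z))"
      by (rule order_trans) (simp only: real_norm_def abs_ge_self)
  qed
  show "(\<lambda>n. exp ((cmod z)\<^sup>2 / 2) / sqrt (fock_moment 0) * fock_norm (\<lambda>z. F n z - f z)) \<longlonglongrightarrow> 0"
    using tendsto_mult_left[OF assms(3), of "exp ((cmod z)\<^sup>2 / 2) / sqrt (fock_moment 0)"] by simp
qed

text \<open>Cutting \<open>g\<close> off at a large radius makes one error uniformly small by Cauchy--Schwarz, while on
  the disc the pointwise bound dominates the sequence.\<close>

lemma fock_pointwise_limit_imp_weak:
  assumes F: "\<And>n. F n \<in> fock_space" "\<And>n. fock_norm (F n) \<le> B"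
    and f: "f \<in> fock_space" and lim: "\<And>z. (\<lambda>n. F n z) \<longlonglongrightarrow> f z"
    and g: "g \<in> fock_space"
  shows "(\<lambda>n. fock_inner g (F n)) \<longlonglongrightarrow> fock_inner g f"
proof -
  define D where "D n z = F n z - f z" for n z
  have D: "D n \<in> fock_space" for n
    unfolding D_def by (rule fock_space_diff[OF F(1) f])
  note [measurable] = fock_spaceD(3)[OF g] fock_spaceD(3)[OF D]
  have fB: "fock_norm f \<le> B"
    using fock_pointwise_limit_in_fock_space[OF F fock_spaceD(1)[OF f] lim] by simp
  have B: "0 \<le> B"
    using F(2)[of 0] fock_norm_nonneg[of "F 0"] by linarith
  have Dle: "\<exists>C. \<forall>n. fock_norm (D n) \<le> C"
  proof (intro exI allI)
    fix n
    have "(fock_norm (D n))\<^sup>2 = (\<integral>z. (cmod (D n z))\<^sup>2 \<partial>fock_measure)"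
      by (simp add: fock_norm_eq)
    also have "\<dots> \<le> (\<integral>z. 2 * (cmod (F n z))\<^sup>2 + 2 * (cmod (f z))\<^sup>2 \<partial>fock_measure)"
    proof (rule integral_mono)
      fix z
      have "(cmod (D n z))\<^sup>2 \<le> (cmod (F n z) + cmod (f z))\<^sup>2"
        unfolding D_def by (intro power_mono norm_triangle_ineq4) auto
      then show "(cmod (D n z))\<^sup>2 \<le> 2 * (cmod (F n z))\<^sup>2 + 2 * (cmod (f z))\<^sup>2"
        using sum_squares_bound[of "cmod (F n z)" "cmod (f z)"] by (simp add: power2_sum)
    qed (use fock_spaceD(2)[OF D] fock_spaceD(2)[OF F(1)] fock_spaceD(2)[OF f] in auto)
    also have "\<dots> = 2 * (fock_norm (F n))\<^sup>2 + 2 * (fock_norm f)\<^sup>2"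
      using fock_spaceD(2)[OF F(1)] fock_spaceD(2)[OF f] by (simp add: fock_norm_eq)
    also have "\<dots> \<le> 2 * B\<^sup>2 + 2 * B\<^sup>2"
      using F(2)[of n] fB by (intro add_mono mult_left_mono power_mono) auto
    also have "\<dots> = (2 * B)\<^sup>2"
      by (simp add: power_mult_distrib)
    finally show "fock_norm (D n) \<le> 2 * B"
      by (rule power2_le_imp_le) (simp add: B)
  qed
  then obtain C where C: "\<And>n. fock_norm (D n) \<le> C" by blast
  have C0: "0 \<le> C"
    using C[of 0] fock_norm_nonneg[of "D 0"] by linarith
  define tail where "tail R = (\<integral>z. (cmod (indicator (- cball 0 (real R)) z * g z))\<^sup>2 \<partial>fock_measure)" for R :: nat
  define I where "I R n = (\<integral>z. (indicator (cball 0 (real R)) z * g z) * cnj (D n z) \<partial>fock_measure)" for R :: nat and n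
  have g2: "integrable fock_measure (\<lambda>z. (cmod (indicator A z * g z))\<^sup>2)" if [measurable]: "A \<in> sets borel" for A
    by (rule Bochner_Integration.integrable_bound[OF fock_spaceD(2)[OF g]]) (auto simp: indicator_def)
  have "(\<lambda>R. tail R) \<longlonglongrightarrow> (\<integral>z. 0 \<partial>fock_measure)"
    unfolding tail_def
  proof (rule integral_dominated_convergence[where w = "\<lambda>z. (cmod (g z))\<^sup>2"])
    show "AE z in fock_measure. (\<lambda>R. (cmod (indicator (- cball 0 (real R)) z * g z))\<^sup>2) \<longlonglongrightarrow> 0"
    proof (rule always_eventually, rule allI, rule tendsto_eventually)
      fix z
      obtain N :: nat where "cmod z \<le> real N"
        using real_arch_simple by blast
      then show "\<forall>\<^sub>F R in sequentially. (cmod (indicator (- cball 0 (real R)) z * g z))\<^sup>2 = 0"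
        by (intro eventually_sequentiallyI[of N]) (simp add: indicator_def)
    qed
  qed (use fock_spaceD(2)[OF g] in \<open>auto simp: indicator_def\<close>)
  then have tail0: "tail \<longlonglongrightarrow> 0" by simp
  \<comment> \<open>The measure is finite, so square integrability implies integrability; this
    supplies the dominating function on discs.\<close>
  have gint: "integrable fock_measure (\<lambda>z. cmod (g z))"
  proof (rule Bochner_Integration.integrable_bound)
    show "integrable fock_measure (\<lambda>z. 1 + (cmod (g z))\<^sup>2)"
      using integrable_fock_moment[of 0] fock_spaceD(2)[OF g] by simp
    have "cmod (g z) \<le> 1 + (cmod (g z))\<^sup>2" for z
    proof -
      have "2 * cmod (g z) \<le> 1 + (cmod (g z))\<^sup>2"
        using sum_squares_bound[of 1 "cmod (g z)"] by simp
      then show ?thesis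
        using norm_ge_zero[of "g z"] by linarith
    qed
    then show "AE z in fock_measure. norm (cmod (g z)) \<le> norm (1 + (cmod (g z))\<^sup>2)"
      by simp
  qed measurable
  have I0: "I R \<longlonglongrightarrow> 0" for R
  proof -
    let ?K = "exp ((real R)\<^sup>2 / 2) / sqrt (fock_moment 0) * C"
    have "I R \<longlonglongrightarrow> (\<integral>z. 0 \<partial>fock_measure)"
      unfolding I_def
    proof (rule integral_dominated_convergence[where w = "\<lambda>z. cmod (g z) * ?K"])
      show "AE z in fock_measure. (\<lambda>n. (indicator (cball 0 (real R)) z * g z) * cnj (D n z)) \<longlonglongrightarrow> 0"
      proof (intro always_eventually allI)
        fix z
        have "(\<lambda>n. (indicator (cball 0 (real R)) z * g z) * cnj (D n z)) \<longlonglongrightarrow>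
            (indicator (cball 0 (real R)) z * g z) * cnj (f z - f z)"
          unfolding D_def by (intro tendsto_intros lim)
        then show "(\<lambda>n. (indicator (cball 0 (real R)) z * g z) * cnj (D n z)) \<longlonglongrightarrow> 0" by simp
      qed
      show "AE z in fock_measure. norm (indicator (cball 0 (real R)) z * g z * cnj (D n z)) \<le> cmod (g z) * ?K" for n
      proof (intro always_eventually allI)
        fix z
        show "norm (indicator (cball 0 (real R)) z * g z * cnj (D n z)) \<le> cmod (g z) * ?K"
        proof (cases "cmod z \<le> real R")
          case True
          have "cmod (D n z) \<le> exp ((cmod z)\<^sup>2 / 2) / sqrt (fock_moment 0) * fock_norm (D n)"
            by (rule fock_pointwise_bound[OF D])
          also have "\<dots> \<le> ?K"
            using True C[of n] fock_moment_pos[of 0] by (intro mult_mono divide_right_mono) auto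
          finally have "cmod (D n z) \<le> ?K" .
          from mult_left_mono[OF this norm_ge_zero[of "g z"]] show ?thesis
            using True by (simp add: norm_mult)
        next
          case False
          then show ?thesis
            using C0 fock_moment_pos[of 0] by simp
        qed
      qed
      show "integrable fock_measure (\<lambda>z. cmod (g z) * ?K)"
        using gint by simp
    qed (auto intro!: borel_measurable_times borel_measurable_indicator borel_measurable_cnj)
    then show ?thesis by simp
  qed
  have split: "cmod (fock_inner g (D n)) \<le> cmod (I R n) + sqrt (tail R) * C" for R n
  proof -
    have eq: "g z * cnj (D n z) = (indicator (cball 0 (real R)) z * g z) * cnj (D n z) +
        (indicator (- cball 0 (real R)) z * g z) * cnj (D n z)" for z
      by (simp add: indicator_def)
    have int: "integrable fock_measure (\<lambda>z. (indicator A z * g z) * cnj (D n z))" if [measurable]: "A \<in> sets borel" for A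
      by (rule integrable_mult_cnj[OF _ _ g2[OF that] fock_spaceD(2)[OF D]]) measurable
    have "fock_inner g (D n) = I R n + (\<integral>z. (indicator (- cball 0 (real R)) z * g z) * cnj (D n z) \<partial>fock_measure)"
      unfolding fock_inner_def I_def eq by (rule Bochner_Integration.integral_add) (auto intro!: int)
    also have "cmod \<dots> \<le> cmod (I R n) + cmod (\<integral>z. (indicator (- cball 0 (real R)) z * g z) * cnj (D n z) \<partial>fock_measure)"
      by (rule norm_triangle_ineq)
    also have "cmod (\<integral>z. (indicator (- cball 0 (real R)) z * g z) * cnj (D n z) \<partial>fock_measure) \<le> sqrt (tail R) * fock_norm (D n)"
      unfolding tail_def fock_norm_eq
      by (rule Cauchy_Schwarz_integral_cnj[OF _ _ g2 fock_spaceD(2)[OF D]]) measurable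
    also have "\<dots> \<le> sqrt (tail R) * C"
      using C by (intro mult_left_mono) (auto simp: tail_def)
    finally show ?thesis by simp
  qed
  have "(\<lambda>n. fock_inner g (D n)) \<longlonglongrightarrow> 0"
  proof (rule LIMSEQ_I)
    fix e :: real assume "e > 0"
    have "(\<lambda>R. sqrt (tail R) * C) \<longlonglongrightarrow> sqrt 0 * C"
      by (intro tendsto_intros tail0)
    then have "\<forall>\<^sub>F R in sequentially. sqrt (tail R) * C < e / 2"
      using \<open>e > 0\<close> by (intro order_tendstoD(2)[where y = "sqrt 0 * C"]) auto
    \<comment> \<open>The radius is fixed first, uniformly in \<open>n\<close>; only then is
      \<open>N\<close> chosen for that radius.\<close>
    then obtain R where R: "sqrt (tail R) * C < e / 2"
      using eventually_happens' sequentially_bot by blast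
    obtain N where N: "\<And>n. n \<ge> N \<Longrightarrow> norm (I R n - 0) < e / 2"
      using LIMSEQ_D[OF I0[of R], of "e / 2"] \<open>e > 0\<close> by auto
    have "norm (fock_inner g (D n) - 0) < e" if "n \<ge> N" for n
      using split[of n R] R N[OF that] by simp
    then show "\<exists>N. \<forall>n\<ge>N. norm (fock_inner g (D n) - 0) < e" by blast
  qed
  moreover have "fock_inner g (D n) = fock_inner g (F n) - fock_inner g f" for n
    using fock_inner_diff_left[OF F(1) f g] fock_inner_commute[of g] unfolding D_def
    by (simp only: fock_inner_commute[of g] complex_cnj_diff)
  ultimately show ?thesis
    by (simp add: LIM_zero_iff)
qed

section \<open>Closedness of the numerical range\<close>

lemma closed_numerical_range_weighted_comp:
  assumes T: "fock_compact (weighted_comp \<psi> \<phi>)" and 0: "0 \<in> numerical_range (weighted_comp \<psi> \<phi>)"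
  shows "closed (numerical_range (weighted_comp \<psi> \<phi>))"
  unfolding closed_sequential_limits
proof (intro allI impI, elim conjE)
  let ?T = "weighted_comp \<psi> \<phi>"
  have lin: "fock_linear ?T"
    using T by (simp add: fock_compact_def)
  fix l and w assume l: "\<forall>n. l n \<in> numerical_range ?T" and lim: "l \<longlonglongrightarrow> w"
  then have "\<forall>n. \<exists>f. l n = fock_inner (?T f) f \<and> f \<in> fock_space \<and> fock_norm f = 1"
    by (auto simp: numerical_range_def)
  then obtain F where F: "\<And>n. l n = fock_inner (?T (F n)) (F n)" "\<And>n. F n \<in> fock_space"
    "\<And>n. fock_norm (F n) = 1"
    by metis
  have "bounded (range (\<lambda>n. fock_norm (F n)))"
    using F by simp
  with T F(2) obtain g r where g: "g \<in> fock_space" and r: "strict_mono (r :: nat \<Rightarrow> nat)"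
    and Tg: "(\<lambda>n. fock_norm (\<lambda>z. ?T (F (r n)) z - g z)) \<longlonglongrightarrow> 0"
    unfolding fock_compact_def by meson
  obtain f q where f: "f \<in> fock_space" "fock_norm f \<le> 1" and q: "strict_mono (q :: nat \<Rightarrow> nat)"
    and Ff: "\<And>z. (\<lambda>n. F (r (q n)) z) \<longlonglongrightarrow> f z"
    using fock_bounded_imp_pointwise_subseq[of "\<lambda>n. F (r n)" 1] F by auto
  define H where "H n = F (r (q n))" for n
  have H: "H n \<in> fock_space" "fock_norm (H n) = 1" for n
    by (simp_all add: H_def F)
  have TH: "(\<lambda>n. fock_norm (\<lambda>z. ?T (H n) z - g z)) \<longlonglongrightarrow> 0"
    using LIMSEQ_subseq_LIMSEQ[OF Tg q] by (simp add: H_def o_def)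
  \<comment> \<open>Norm convergence implies pointwise convergence to \<open>g\<close>, while a
    weighted composition operator acts pointwise and so respects the pointwise limit
    \<open>f\<close>.\<close>
  have "g z = ?T f z" for z
  proof (rule LIMSEQ_unique)
    show "(\<lambda>n. ?T (H n) z) \<longlonglongrightarrow> g z"
      by (rule fock_norm_limit_imp_pointwise[OF fock_linearD(1)[OF lin H(1)] g TH])
    show "(\<lambda>n. ?T (H n) z) \<longlonglongrightarrow> ?T f z"
      unfolding weighted_comp_def H_def by (intro tendsto_intros Ff)
  qed
  then have g_eq: "g = ?T f" by blast
  \<comment> \<open>The quadratic form at \<open>H n\<close> is split into this error, controlled by
    norm convergence against unit vectors, and \<open>fock_inner g (H n)\<close>, handled by weak
    convergence.\<close>
  have "(\<lambda>n. fock_inner (\<lambda>z. ?T (H n) z - g z) (H n)) \<longlonglongrightarrow> 0"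
  proof (rule Lim_null_comparison[OF always_eventually TH], intro allI)
    fix n
    show "norm (fock_inner (\<lambda>z. ?T (H n) z - g z) (H n)) \<le> fock_norm (\<lambda>z. ?T (H n) z - g z)"
      using fock_Cauchy_Schwarz[OF fock_space_diff[OF fock_linearD(1)[OF lin H(1)] g] H(1)] H(2) by simp
  qed
  moreover have "(\<lambda>n. fock_inner g (H n)) \<longlonglongrightarrow> fock_inner g f"
    using H Ff by (intro fock_pointwise_limit_imp_weak[where B = 1] f g) (auto simp: H_def)
  ultimately have "(\<lambda>n. fock_inner (\<lambda>z. ?T (H n) z - g z) (H n) + fock_inner g (H n)) \<longlonglongrightarrow> 0 + fock_inner g f"
    by (rule tendsto_add)
  moreover have "fock_inner (\<lambda>z. ?T (H n) z - g z) (H n) + fock_inner g (H n) = l (r (q n))" for n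
    unfolding F(1) H_def[symmetric] fock_inner_diff_left[OF fock_linearD(1)[OF lin H(1)] g H(1)] by simp
  moreover have "(\<lambda>n. l (r (q n))) \<longlonglongrightarrow> w"
    using LIMSEQ_subseq_LIMSEQ[OF LIMSEQ_subseq_LIMSEQ[OF lim r] q] by (simp add: o_def)
  ultimately have w: "w = fock_inner (?T f) f"
    using LIMSEQ_unique g_eq by fastforce
  show "w \<in> numerical_range ?T"
  proof (cases "fock_norm f = 0")
    case True
    then have "f = (\<lambda>z. 0)"
      using fock_norm_eq_0_imp[OF f(1)] by blast
    then show ?thesis
      using 0 w by (simp add: fock_inner_def)
  next
    case False
    \<comment> \<open>The weak limit may lose norm; its squared norm is the weight placing
      \<open>w\<close> between 0 and the value at the normalised \<open>f\<close>.\<close>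
    let ?s = "(fock_norm f)\<^sup>2"
    have s: "0 \<le> ?s" "?s \<le> 1"
      using f(2) by (auto simp: power_le_one)
    have "(1 - ?s) *\<^sub>R 0 + ?s *\<^sub>R (fock_inner (?T f) f / complex_of_real ?s) \<in> numerical_range ?T"
      using s by (intro convexD[OF convex_numerical_range[OF lin] 0 numerical_range_memI[OF lin f(1) False]]) auto
    then show ?thesis
      using False by (simp add: w scaleR_conv_of_real)
  qed
qed

theorem theorem2p2:
  fixes \<psi> \<phi> :: "complex \<Rightarrow> complex" and a b :: complex
  assumes "\<psi> holomorphic_on UNIV"
    and "\<And>z. \<phi> z = a * z + b"
    and "0 < cmod a" and "cmod a < 1"
    and "\<psi> (b / (1 - a)) \<noteq> 0"
    and "fock_compact (weighted_comp \<psi> \<phi>)"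
    and "\<not> (\<exists>r::real. r > 0 \<and> a = complex_of_real r)"
  shows "0 \<in> numerical_range (weighted_comp \<psi> \<phi>) \<and> closed (numerical_range (weighted_comp \<psi> \<phi>))"
proof -
  have \<phi>: "\<phi> = (\<lambda>z. a * z + b)"
    using assms(2) by blast
  have lin: "fock_linear (weighted_comp \<psi> \<phi>)"
    using assms(6) by (simp add: fock_compact_def)
  define p where "p = b / (1 - a)"
  have "1 - a \<noteq> 0"
    using assms(4) by auto
  then have p: "a * p + b = p"
    by (simp add: p_def field_simps)
  have "0 \<in> numerical_range (weighted_comp \<psi> \<phi>)"
  proof (rule zero_in_convex_geometric[OF convex_numerical_range[OF lin]])
    show "\<psi> p * a ^ n \<in> numerical_range (weighted_comp \<psi> \<phi>)" for n
      using diagonal_in_numerical_range[OF assms(1) _ p] lin unfolding \<phi> by blast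
  qed (use assms(3,7) in auto)
  then show ?thesis
    using closed_numerical_range_weighted_comp[OF assms(6)] by blast
qed

end
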